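(* Let $F=H+\overline{G}$ be a harmonic mapping that is sense-preserving and uniformly locally univalent in $\mathbb{D}$. Then for each $\varepsilon\in\overline{\mathbb{D}}$, every harmonic mapping $f_\varepsilon=h_\varepsilon+\overline{g_\varepsilon}$ in $\mathbb{D}$ with $h_\varepsilon=\log(H'+\varepsilon G')$ and with $\omega=g'_\varepsilon/h'_\varepsilon$ bounded in $\mathbb{D}$ belongs to $\mathcal{B}^*_H(1)$.
   Context: $\mathbb{D}=\{z\in\mathbb{C}:|z|<1\}$. A harmonic mapping in $\mathbb{D}$ is a complex-valued $f$ with $f_{z\overline z}=0$; it has a canonical decomposition $f=h+\overline g$ with $h,g$ analytic in $\mathbb{D}$ and $g(0)=0$. Its Jacobian is $J_f=|h'|^2-|g'|^2$. It is called sense-preserving (and locally univalent) when $J_f>0$ in $\mathbb{D}$, i.e. $|g'|<|h'|$ in $\mathbb{D}$. A harmonic mapping $f$ in $\mathbb{D}$ is uniformly locally univalent (ULU) if there is a constant $\rho>0$ such that $f$ is univalent (injective) on the hyperbolic disk $D_h(a,\rho)=\{z\in\mathbb{D}:|\frac{z-a}{1-\overline a z}|<\tanh\rho\}$ for every $a\in\mathbb{D}$. $\mathcal{B}^*_H(1)$ is the set of harmonic mappings $f$ in $\mathbb{D}$ with $\sup_{z\in\mathbb{D}}(1-|z|^2)\sqrt{|J_f(z)|}<\infty$. Since $|G'|<|H'|$, the function $H'+\varepsilon G'$ has no zeros in $\mathbb{D}$, and $\log(H'+\varepsilon G')$ denotes an analytic branch of the logarithm in $\mathbb{D}$. The condition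 that $\omega=g'_\varepsilon/h'_\varepsilon$ is bounded means that $g'_\varepsilon=\omega h'_\varepsilon$ in $\mathbb{D}$ for a bounded function $\omega$ on $\mathbb{D}$. *)

theory Defs
  imports "HOL-Complex_Analysis.Complex_Analysis"
begin

abbreviation unit_disk :: "complex set" where
  "unit_disk \<equiv> ball 0 1"

definition wirtinger_z :: "(complex \<Rightarrow> complex) \<Rightarrow> complex \<Rightarrow> complex" where
  "wirtinger_z f z =
     (frechet_derivative f (at z) 1 - \<i> * frechet_derivative f (at z) \<i>) / 2"

definition wirtinger_zbar :: "(complex \<Rightarrow> complex) \<Rightarrow> complex \<Rightarrow> complex" where
  "wirtinger_zbar f z =
     (frechet_derivative f (at z) 1 + \<i> * frechet_derivative f (at z) \<i>) / 2"

(* The two (real) differentiability conditions only make the mixed derivative meaningful.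
   Together with its vanishing they force wirtinger_z f to be holomorphic, hence f to be
   smooth, so that requiring f to be of class C^2 would define the same mappings. *)
definition harmonic_mapping :: "(complex \<Rightarrow> complex) \<Rightarrow> bool" where
  "harmonic_mapping f \<longleftrightarrow>
     (\<forall>z\<in>unit_disk. f differentiable (at z) \<and>
        wirtinger_z f differentiable (at z) \<and>
        wirtinger_zbar (wirtinger_z f) z = 0)"

definition canonical_decomposition ::
    "(complex \<Rightarrow> complex) \<Rightarrow> (complex \<Rightarrow> complex) \<Rightarrow> (complex \<Rightarrow> complex) \<Rightarrow> bool" where
  "canonical_decomposition f h g \<longleftrightarrow>
     h holomorphic_on unit_disk \<and> g holomorphic_on unit_disk \<and> g 0 = 0 \<and>
     (\<forall>z\<in>unit_disk. f z = h z + cnj (g z))"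

(* The Jacobian of h + cnj g. *)
definition harmonic_jacobian ::
    "(complex \<Rightarrow> complex) \<Rightarrow> (complex \<Rightarrow> complex) \<Rightarrow> complex \<Rightarrow> real" where
  "harmonic_jacobian h g z = (cmod (deriv h z))\<^sup>2 - (cmod (deriv g z))\<^sup>2"

definition hyperbolic_disk :: "complex \<Rightarrow> real \<Rightarrow> complex set" where
  "hyperbolic_disk a \<rho> = {z \<in> unit_disk. cmod ((z - a) / (1 - cnj a * z)) < tanh \<rho>}"

definition uniformly_locally_univalent :: "(complex \<Rightarrow> complex) \<Rightarrow> bool" where
  "uniformly_locally_univalent f \<longleftrightarrow>
     (\<exists>\<rho>>0. \<forall>a\<in>unit_disk. inj_on f (hyperbolic_disk a \<rho>))"

(* The canonical decomposition of f is unique on the disk, so the existential quantifier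
   only names its parts. *)
definition harmonic_bloch_star :: "(complex \<Rightarrow> complex) set" where
  "harmonic_bloch_star =
     {f. harmonic_mapping f \<and>
         (\<exists>h g. canonical_decomposition f h g \<and>
            bdd_above ((\<lambda>z. (1 - (cmod z)\<^sup>2) * sqrt \<bar>harmonic_jacobian h g z\<bar>) ` unit_disk))}"

end

theory Submission
  imports Defs
begin

text \<open>
  Everything rests on a bound \<open>R |h''(a)| \<le> K |h'(a)|\<close> with an absolute constant \<open>K\<close> for injective,
  sense-preserving \<open>h + cnj g\<close> on \<open>ball a R\<close>. If it fails, choose \<open>z0\<close> maximising
  \<open>(R/2 - |z - a|) |h''/h'|\<close> and rescale by \<open>h''(z0)/h'(z0)\<close>: this gives an injective mapping
  on a huge disk with \<open>|h''/h'| \<le> 2\<close>, and \<open>h''/h' = 1\<close> at the centre. By the Schwarz lemma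
  \<open>h''/h'\<close> is almost 1 on a fixed disk and by the Schwarz--Pick lemma the dilatation \<open>g'/h'\<close> is almost
  constant, so the mapping is close to an injective real-linear map applied to \<open>exp\<close>; by Brouwer's theorem
  it takes its value at 0 again near \<open>2\<pi>i\<close>, a contradiction.

  For \<open>|\<epsilon>| < 1\<close> the mapping \<open>F + \<epsilon> cnj F\<close> is as injective as \<open>F\<close>, sense-preserving, and has analytic part
  \<open>H + \<epsilon> G\<close>, so the bound applies on Euclidean disks inside the hyperbolic ones;
  \<open>|\<epsilon>| = 1\<close> follows by continuity.
\<close>

section \<open>Schwarz and Schwarz-Pick estimates on disks of radius \<open>N\<close>\<close>

lemma Schwarz_ball:
  assumes holf: "f holomorphic_on ball 0 N" and f0: "f 0 = 0"
    and less: "\<And>z. z \<in> ball 0 N \<Longrightarrow> cmod (f z) < M" and z: "z \<in> ball 0 N"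
  shows "cmod (f z) \<le> M * cmod z / N"
proof -
  have N: "N > 0" using z by (auto intro: le_less_trans[OF norm_ge_zero])
  have M: "M > 0" using less[OF z] by (auto intro: le_less_trans[OF norm_ge_zero])
  have scale: "of_real N * \<zeta> \<in> ball 0 N" if "\<zeta> \<in> ball 0 1" for \<zeta> :: complex
    using that N by (simp add: norm_mult)
  have hol: "(\<lambda>\<zeta>. f (of_real N * \<zeta>) / of_real M) holomorphic_on ball 0 1"
    using scale M
    by (intro holomorphic_intros holomorphic_on_compose_gen[OF _ holf, unfolded o_def]) auto
  have "cmod (f (of_real N * (z / of_real N)) / of_real M) \<le> cmod (z / of_real N)"
    using z N M f0 less[OF scale]
    by (intro Schwarz_Lemma(1)[OF hol]) (auto simp: norm_divide)
  then show ?thesis using N M by (simp add: norm_divide field_simps)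
qed

text \<open>The rescaled Schwarz lemma is applied to the Moebius image of \<open>\<omega>\<close>
  that vanishes at 0.\<close>

lemma Schwarz_Pick_ball:
  assumes hol: "\<omega> holomorphic_on ball 0 N"
    and less: "\<And>z. z \<in> ball 0 N \<Longrightarrow> cmod (\<omega> z) < 1" and z: "z \<in> ball 0 N"
  shows "cmod (\<omega> z - \<omega> 0) \<le> cmod z / N * cmod (1 - cnj (\<omega> 0) * \<omega> z)"
proof -
  have N: "N > 0" using z by (auto intro: le_less_trans[OF norm_ge_zero])
  have w0: "cmod (\<omega> 0) < 1" using less N by simp
  have nz: "1 - cnj (\<omega> 0) * \<omega> x \<noteq> 0" if "x \<in> ball 0 N" for x
  proof
    assume "1 - cnj (\<omega> 0) * \<omega> x = 0"
    then have "cmod (\<omega> 0) * cmod (\<omega> x) = 1"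
      by (metis complex_mod_cnj eq_iff_diff_eq_0 norm_mult norm_one)
    then show False
      using w0 less[OF that] mult_left_le_one_le[of "cmod (\<omega> x)" "cmod (\<omega> 0)"] by simp
  qed
  have "cmod ((\<omega> z - \<omega> 0) / (1 - cnj (\<omega> 0) * \<omega> z)) \<le> 1 * cmod z / N"
    using nz Moebius_function_norm_lt_1[OF w0 less, of _ 0]
    by (intro Schwarz_ball[OF _ _ _ z] holomorphic_intros hol)
       (auto simp: Moebius_function_simple)
  then show ?thesis using nz[OF z] by (simp add: norm_divide field_simps)
qed

text \<open>The factor \<open>1 - cmod (\<omega> 0)\<close> is the point: an equation will be solved
  by dividing by 1 - |\<omega>(0)|^2, and this factor keeps the estimate uniform as |\<omega>(0)|
  tends to 1.\<close>

lemma Schwarz_Pick_deviation: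
  assumes hol: "\<omega> holomorphic_on ball 0 N"
    and less: "\<And>z. z \<in> ball 0 N \<Longrightarrow> cmod (\<omega> z) < 1" and z: "cmod z \<le> N / 2" and N: "N > 0"
  shows "cmod (\<omega> z - \<omega> 0) \<le> 4 * cmod z / N * (1 - cmod (\<omega> 0))"
proof -
  define t r d where "t = cmod z / N" and "r = cmod (\<omega> 0)" and "d = cmod (\<omega> z - \<omega> 0)"
  have t: "0 \<le> t" "t \<le> 1/2" using z N by (auto simp: t_def field_simps)
  have r: "0 \<le> r" "r < 1" using less[of 0] N by (auto simp: r_def)
  have d0: "d \<ge> 0" by (simp add: d_def)
  have "1 - cnj (\<omega> 0) * \<omega> z = of_real (1 - r\<^sup>2) - cnj (\<omega> 0) * (\<omega> z - \<omega> 0)"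
    using complex_norm_square[of "\<omega> 0"] by (simp add: r_def algebra_simps)
  then have "cmod (1 - cnj (\<omega> 0) * \<omega> z) \<le> \<bar>1 - r\<^sup>2\<bar> + r * d"
    using norm_triangle_ineq4[of "of_real (1 - r\<^sup>2)" "cnj (\<omega> 0) * (\<omega> z - \<omega> 0)"]
    by (simp add: norm_mult r_def d_def del: of_real_diff)
  also have "\<bar>1 - r\<^sup>2\<bar> = (1 - r) * (1 + r)"
    using r by (simp add: abs_square_le_1 power2_eq_square algebra_simps mult_le_one)
  also have "\<dots> + r * d \<le> (1 - r) * 2 + d"
    using r d0 by (intro add_mono mult_left_mono) (auto simp: mult_left_le_one_le)
  finally have le: "cmod (1 - cnj (\<omega> 0) * \<omega> z) \<le> 2 * (1 - r) + d" by simp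
  have "d \<le> t * cmod (1 - cnj (\<omega> 0) * \<omega> z)"
    using Schwarz_Pick_ball[OF hol less, of z] z N by (simp add: t_def d_def)
  also have "\<dots> \<le> t * (2 * (1 - r) + d)"
    using le t by (intro mult_left_mono)
  \<comment> \<open>Since t \<le> 1/2, the term \<open>t * d\<close> is absorbed into half of the
    left-hand side; this turns the factor 2 into 4.\<close>
  also have "\<dots> \<le> 2 * t * (1 - r) + d / 2"
    using t d0 mult_right_mono[of t "1/2" d] by (simp add: algebra_simps)
  finally show ?thesis by (simp add: t_def r_def d_def field_simps)
qed


section \<open>Elementary bounds for the complex exponential near 0\<close>

lemma exp_abs_Re_le_2:
  assumes "cmod u \<le> 1/2"
  shows "exp \<bar>Re u\<bar> \<le> 2"
proof -
  have "exp \<bar>Re u\<bar> \<le> 1 + 2 * \<bar>Re u\<bar>"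
    using abs_Re_le_cmod[of u] assms by (intro order_trans[OF exp_bound_lemma[of "\<bar>Re u\<bar>", simplified]]) auto
  also have "\<dots> \<le> 2"
    using abs_Re_le_cmod[of u] assms by simp
  finally show ?thesis .
qed

lemma cmod_exp_minus_1_le:
  fixes u :: complex
  assumes "cmod u \<le> 1/2"
  shows "cmod (exp u - 1) \<le> 2 * cmod u"
proof -
  have "exp \<bar>Re u\<bar> * cmod u \<le> 2 * cmod u"
    using exp_abs_Re_le_2[OF assms] by (intro mult_right_mono) auto
  with Taylor_exp[of u 0] show ?thesis by simp
qed

lemma cmod_exp_minus_1_minus_le:
  fixes u :: complex
  assumes "cmod u \<le> 1/2"
  shows "cmod (exp u - 1 - u) \<le> 2 * (cmod u)\<^sup>2"
proof -
  have "exp \<bar>Re u\<bar> * (cmod u)\<^sup>2 \<le> 2 * (cmod u)\<^sup>2"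
    using exp_abs_Re_le_2[OF assms] by (intro mult_right_mono) auto
  with Taylor_exp[of u 1] show ?thesis by (simp add: power2_eq_square algebra_simps)
qed

section \<open>Failure of injectivity close to the exponential\<close>

text \<open>If \<open>L\<close> were the identity and \<open>\<omega>\<close> a constant a, the
  mapping would be, up to a constant, w + cnj a * cnj w with w = exp z - 1, which has period 2 pi i.
  For large \<open>N\<close> the deviation from this model is small on a fixed disk, so a second
  solution survives near 2 pi i.\<close>

lemma not_inj_on_near_exp:
  assumes N: "N \<ge> 100000 * exp 9"
    and holL: "L holomorphic_on ball 0 N" and L0: "L 0 = 0" and L1: "deriv L 0 = 1"
    and L2: "\<And>z. z \<in> ball 0 N \<Longrightarrow> cmod (deriv L z) \<le> 2"
    and hol\<omega>: "\<omega> holomorphic_on ball 0 N"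
    and \<omega>: "\<And>z. z \<in> ball 0 N \<Longrightarrow> cmod (\<omega> z) < 1"
    and h: "\<And>z. z \<in> ball 0 N \<Longrightarrow> (h has_field_derivative exp (L z)) (at z)"
    and g: "\<And>z. z \<in> ball 0 N \<Longrightarrow> (g has_field_derivative \<omega> z * exp (L z)) (at z)"
  shows "\<not> inj_on (\<lambda>z. h z + cnj (g z)) (ball 0 N)"
proof
  assume inj: "inj_on (\<lambda>z. h z + cnj (g z)) (ball 0 N)"
  \<comment> \<open>The disk of radius 9 contains the disk of radius 1/4 about 2 pi i, even with the
    crude bound pi < 4; \<open>B\<close> bounds |exp| on it.\<close>
  define B where "B = exp (9::real)"
  define a where "a = \<omega> 0"
  define r where "r = cmod a"
  define e where "e = (\<lambda>z. g z - g 0 - a * (h z - h 0))"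
  \<comment> \<open>\<open>E z\<close> solves \<open>E + cnj a * cnj E = cnj (e z)\<close>, so that \<open>h z + cnj (g z) = h 0 + cnj (g 0)\<close>
      is equivalent to \<open>h z - h 0 + E z = 0\<close>.\<close>
  define E where "E = (\<lambda>z. (cnj (e z) - cnj a * e z) / of_real (1 - r\<^sup>2))"
  have B: "B \<ge> 1" by (simp add: B_def)
  have N1: "N \<ge> 100000 * B" using N by (simp add: B_def)
  with B have N0: "N > 0" "N \<ge> 100000" by linarith+
  have sub: "z \<in> ball 0 N" if "cmod z \<le> 9" for z using that N0 by simp
  have r: "0 \<le> r" "r < 1" using \<omega>[of 0] N0 by (auto simp: r_def a_def)
  \<comment> \<open>\<open>deriv L - 1\<close> vanishes at 0 and is bounded, so the Schwarz lemma
    gives decay of order 1/N; integration passes this on to \<open>L\<close>, and through exp to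
    \<open>h\<close>.\<close>
  have L'1: "cmod (deriv L z - 1) \<le> 36 / N" if "cmod z \<le> 9" for z
  proof -
    have "cmod (deriv L x - 1) < 4" if "x \<in> ball 0 N" for x
      using norm_triangle_ineq4[of "deriv L x" 1] L2[OF that] by simp
    then have "cmod (deriv L z - 1) \<le> 4 * cmod z / N"
      by (intro Schwarz_ball[of _ N, OF _ _ _ sub[OF that]] holomorphic_intros holL) (auto simp: L1)
    also have "\<dots> \<le> 36 / N" using that N0 by (simp add: field_simps)
    finally show ?thesis .
  qed
  have Lz: "cmod (L z - z) \<le> 324 / N" if "cmod z \<le> 9" for z
  proof -
    have "cmod ((L z - z) - (L 0 - 0)) \<le> 36 / N * cmod (z - 0)"
    proof (rule field_differentiable_bound[of "cball 0 9" "\<lambda>z. L z - z" "\<lambda>z. deriv L z - 1"])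
      fix x :: complex assume "x \<in> cball 0 9"
      then have "x \<in> ball 0 N" using sub by simp
      then show "((\<lambda>z. L z - z) has_field_derivative deriv L x - 1) (at x within cball 0 9)"
        by (intro has_field_derivative_at_within[OF DERIV_diff] DERIV_ident
              holomorphic_derivI[OF holL open_ball])
    qed (use L'1 that in auto)
    also have "\<dots> \<le> 36 / N * 9" using that N0 by (intro mult_left_mono) auto
    finally show ?thesis using L0 by simp
  qed
  have expL: "cmod (exp (L z) - exp z) \<le> 648 * B / N" if "cmod z \<le> 9" for z
  proof -
    have "exp (L z) - exp z = exp z * (exp (L z - z) - 1)"
      by (simp add: algebra_simps mult_exp_exp)
    then have "cmod (exp (L z) - exp z) = cmod (exp z) * cmod (exp (L z - z) - 1)"
      by (simp only: norm_mult)
    also have "cmod (exp z) \<le> B"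
      using that complex_Re_le_cmod[of z] by (simp add: B_def)
    also have "324 / N \<le> 1/2" using N0 by (simp add: field_simps)
    then have "cmod (exp (L z - z) - 1) \<le> 2 * (324 / N)"
      using cmod_exp_minus_1_le[of "L z - z"] Lz[OF that] by linarith
    finally show ?thesis using B by (simp add: mult_left_mono mult_right_mono field_simps)
  qed
  have hz: "cmod (h z - h 0 - (exp z - 1)) \<le> 5832 * B / N" if "cmod z \<le> 9" for z
  proof -
    have "cmod ((h z - exp z) - (h 0 - exp 0)) \<le> 648 * B / N * cmod (z - 0)"
    proof (rule field_differentiable_bound[of "cball 0 9" "\<lambda>z. h z - exp z" "\<lambda>z. exp (L z) - exp z"])
      fix x :: complex assume "x \<in> cball 0 9"
      then have "x \<in> ball 0 N" using sub by simp
      then show "((\<lambda>z. h z - exp z) has_field_derivative exp (L x) - exp x) (at x within cball 0 9)"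
        by (intro has_field_derivative_at_within[OF DERIV_diff] DERIV_exp h)
    qed (use expL that in auto)
    also have "\<dots> \<le> 648 * B / N * 9" using that N0 B by (intro mult_left_mono) auto
    finally show ?thesis by (simp add: algebra_simps)
  qed
  \<comment> \<open>\<open>e\<close> measures how far g - g 0 is from a times h - h 0. Its
    derivative (\<omega> - a) exp L inherits the factor 1 - r from
    \<open>Schwarz_Pick_deviation\<close>.\<close>
  have ez: "cmod (e z) \<le> 648 * B / N * (1 - r)" if "cmod z \<le> 9" for z
  proof -
    have "cmod (e z - e 0) \<le> (36 / N * (1 - r) * (2 * B)) * cmod (z - 0)"
    proof (rule field_differentiable_bound[of "cball 0 9" e "\<lambda>z. (\<omega> z - a) * exp (L z)"])
      fix x :: complex assume x: "x \<in> cball 0 9"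
      then have xN: "x \<in> ball 0 N" using sub by simp
      have "(e has_field_derivative \<omega> x * exp (L x) - 0 - a * (exp (L x) - 0)) (at x)"
        unfolding e_def by (intro DERIV_diff DERIV_cmult DERIV_const h g xN)
      then show "(e has_field_derivative (\<omega> x - a) * exp (L x)) (at x within cball 0 9)"
        by (simp add: has_field_derivative_at_within algebra_simps)
      have "648 * B / N \<le> B" using N0 B by (simp add: field_simps)
      moreover have "cmod (exp x) \<le> B"
        using x complex_Re_le_cmod[of x] by (simp add: B_def)
      ultimately have "cmod (exp (L x)) \<le> 2 * B"
        using expL[of x] x norm_triangle_sub[of "exp (L x)" "exp x"] by simp
      moreover have "cmod (\<omega> x - a) \<le> 36 / N * (1 - r)"
      proof -
        have "cmod (\<omega> x - a) \<le> 4 * cmod x / N * (1 - r)"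
          using x N0 unfolding a_def r_def by (intro Schwarz_Pick_deviation hol\<omega> \<omega>) auto
        also have "\<dots> \<le> 36 / N * (1 - r)"
          using x N0 r by (intro mult_right_mono) (auto simp: field_simps)
        finally show ?thesis .
      qed
      ultimately show "cmod ((\<omega> x - a) * exp (L x)) \<le> 36 / N * (1 - r) * (2 * B)"
        unfolding norm_mult using r N0 by (intro mult_mono) auto
    qed (use that in auto)
    also have "\<dots> \<le> (36 / N * (1 - r) * (2 * B)) * 9"
      using that N0 B r by (intro mult_left_mono) auto
    also have "\<dots> = 648 * B / N * (1 - r)" by simp
    finally show ?thesis by (simp add: e_def)
  qed
  have r2: "1 - r\<^sup>2 = (1 - r) * (1 + r)" by (simp add: power2_eq_square algebra_simps)
  have r2': "1 - r\<^sup>2 > 0" unfolding r2 using r by simp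
  \<comment> \<open>The numerator of \<open>E\<close> costs a factor 1 + r, and (1 - r)(1 + r)
    cancels against the denominator, so the bound is free of r.\<close>
  have Ez: "cmod (E z) \<le> 648 * B / N" if "cmod z \<le> 9" for z
  proof -
    have "cmod (E z) = cmod (cnj (e z) - cnj a * e z) / (1 - r\<^sup>2)"
      using r2' by (simp add: E_def norm_divide del: of_real_diff)
    also have "\<dots> \<le> (cmod (e z) * (1 + r)) / (1 - r\<^sup>2)"
      using norm_triangle_ineq4[of "cnj (e z)" "cnj a * e z"] r2'
      by (intro divide_right_mono) (auto simp: norm_mult r_def algebra_simps)
    also have "\<dots> = cmod (e z) / (1 - r)" using r unfolding r2 by simp
    also have "\<dots> \<le> 648 * B / N" using ez[OF that] r by (simp add: pos_divide_le_eq)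
    finally show ?thesis .
  qed
  \<comment> \<open>The threshold on \<open>N\<close> is chosen for this: the total error stays
    below half of the radius 1/4 used for the fixed point.\<close>
  have total: "5832 * B / N + 648 * B / N \<le> 1 / 8"
    using N1 N0 by (simp add: field_simps)
  define c where "c = 2 * of_real pi * \<i>"
  \<comment> \<open>Fixed points of \<open>T\<close> are the zeros of h z - h 0 + E z. As exp has
    derivative 1 at \<open>c\<close>, this is a Newton step with frozen derivative. Brouwer's
    theorem asks only for the size of the error, not for a Lipschitz bound on the non-holomorphic
    \<open>E\<close>.\<close>
  define T where "T = (\<lambda>z. z - (h z - h 0) - E z)"
  have near: "cmod z \<le> 9" if "z \<in> cball c (1/4)" for z
    using that norm_triangle_sub[of z c] pi_less_4
    by (simp add: c_def dist_norm norm_mult norm_minus_commute)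
  obtain z where z: "z \<in> cball c (1/4)" and Tz: "T z = z"
  proof (rule brouwer_ball[of "1/4" c T])
    have "h field_differentiable at x within S" "g field_differentiable at x within S"
      if "x \<in> cball c (1/4)" for x S
      using h[OF sub[OF near[OF that]]] g[OF sub[OF near[OF that]]]
      by (auto simp: field_differentiable_def intro: has_field_derivative_at_within)
    then have "h holomorphic_on cball c (1/4)" "g holomorphic_on cball c (1/4)"
      by (auto simp: holomorphic_on_def)
    then have "continuous_on (cball c (1/4)) h" "continuous_on (cball c (1/4)) g"
      by (auto intro: holomorphic_on_imp_continuous_on)
    then show "continuous_on (cball c (1/4)) T"
      unfolding T_def E_def e_def using r2' by (intro continuous_intros) (auto simp del: of_real_diff)
    show "T \<in> cball c (1/4) \<rightarrow> cball c (1/4)"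
    proof
      fix z assume z: "z \<in> cball c (1/4)"
      define u where "u = z - c"
      have u: "cmod u \<le> 1/4" using z by (simp add: u_def dist_norm norm_minus_commute)
      have "exp u = exp z" by (simp add: u_def c_def exp_diff exp_two_pi_i)
      \<comment> \<open>The first term is quadratic in u, hence at most 2 (1/4)^2 = 1/8; the other
        two add at most 1/8 by \<open>total\<close>.\<close>
      then have "c - T z = (exp u - 1 - u) + (h z - h 0 - (exp z - 1)) + E z"
        by (simp add: T_def u_def)
      then have "cmod (c - T z) \<le> cmod (exp u - 1 - u) + cmod (h z - h 0 - (exp z - 1)) + cmod (E z)"
        by (metis norm_triangle_mono norm_triangle_ineq order_refl)
      moreover have "cmod (exp u - 1 - u) \<le> 1/8"
        using cmod_exp_minus_1_minus_le[of u] u power_mono[of "cmod u" "1/4" 2]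
        by (simp add: power2_eq_square)
      ultimately show "T z \<in> cball c (1/4)"
        using hz[OF near[OF z]] Ez[OF near[OF z]] total by (simp add: dist_norm)
    qed
  qed auto
  have hE: "h z - h 0 = - E z" using Tz by (simp add: T_def algebra_simps)
  have aa: "a * cnj a = of_real (r\<^sup>2)" using complex_norm_square[of a] by (simp add: r_def)
  have "E z + cnj a * cnj (E z) = (cnj (e z) * (1 - a * cnj a)) / of_real (1 - r\<^sup>2)"
    by (simp add: E_def add_divide_distrib[symmetric] algebra_simps)
  also have "1 - a * cnj a = of_real (1 - r\<^sup>2)" unfolding aa by simp
  also have "cnj (e z) * of_real (1 - r\<^sup>2) / of_real (1 - r\<^sup>2) = cnj (e z)"
    using r2' by (intro nonzero_mult_div_cancel_right) (simp del: of_real_diff)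
  finally have Ee: "E z + cnj a * cnj (E z) = cnj (e z)" .
  \<comment> \<open>As h z - h 0 = - E z, the equation solved by \<open>E\<close> turns the
    conjugate of g z - g 0 into E z, so the two increments cancel.\<close>
  have "g z - g 0 = e z + a * (h z - h 0)" by (simp add: e_def)
  then have "cnj (g z - g 0) = cnj (e z) - cnj a * cnj (E z)"
    unfolding hE by simp
  also have "\<dots> = E z" unfolding Ee[symmetric] by simp
  finally have "cnj (g z) - cnj (g 0) = E z" by simp
  then have "h z + cnj (g z) = h 0 + cnj (g 0)"
    using hE by (simp add: algebra_simps)
  then have "z = 0"
    using inj_onD[OF inj _ sub[OF near[OF z]], of 0] N0 by simp
  then show False
    using z pi_ge_two by (simp add: c_def norm_mult)
qed


section \<open>Rescaling and the pre-Schwarzian bound for injective mappings\<close>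

text \<open>Here \<open>deriv L\<close> is h''/h'. The constant is four times the threshold of
  \<open>not_inj_on_near_exp\<close>: one factor 2 is lost to the radius R/2, another to halving the
  disk about the maximum point.\<close>

lemma deriv_log_bound_of_inj_on:
  assumes R: "R > 0"
    and holL: "L holomorphic_on ball a R" and hol\<omega>: "\<omega> holomorphic_on ball a R"
    and \<omega>: "\<And>z. z \<in> ball a R \<Longrightarrow> cmod (\<omega> z) < 1"
    and h: "\<And>z. z \<in> ball a R \<Longrightarrow> (h has_field_derivative exp (L z)) (at z)"
    and g: "\<And>z. z \<in> ball a R \<Longrightarrow> (g has_field_derivative \<omega> z * exp (L z)) (at z)"
    and inj: "inj_on (\<lambda>z. h z + cnj (g z)) (ball a R)"
  shows "R * cmod (deriv L a) \<le> 400000 * exp 9"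
proof (rule ccontr)
  assume "\<not> ?thesis"
  then have big: "R * cmod (deriv L a) > 400000 * exp 9" by simp
  define N :: real where "N = 100000 * exp 9"
  have N: "N > 0" by (simp add: N_def)
  \<comment> \<open>The weight vanishes on the boundary circle, so a positive maximum is attained at
    a distance d > 0 from it.\<close>
  define \<phi> where "\<phi> = (\<lambda>z. (R / 2 - cmod (z - a)) * cmod (deriv L z))"
  have half: "cball a (R / 2) \<subseteq> ball a R" using R by auto
  have "continuous_on (cball a (R / 2)) (deriv L)"
    using holomorphic_deriv[OF holL open_ball] half
    by (meson continuous_on_subset holomorphic_on_imp_continuous_on)
  then have "continuous_on (cball a (R / 2)) \<phi>"
    unfolding \<phi>_def by (intro continuous_intros)
  then obtain z0 where z0: "z0 \<in> cball a (R / 2)"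
    and max: "\<And>z. z \<in> cball a (R / 2) \<Longrightarrow> \<phi> z \<le> \<phi> z0"
    using continuous_attains_sup[of "cball a (R / 2)" \<phi>] R by auto
  define d p where "d = R / 2 - cmod (z0 - a)" and "p = deriv L z0"
  have d0: "d \<ge> 0" using z0 by (simp add: d_def dist_norm norm_minus_commute)
  have "\<phi> a = R * cmod (deriv L a) / 2" by (simp add: \<phi>_def)
  then have dp: "d * cmod p > 2 * N"
    using max[of a] R big by (simp add: N_def \<phi>_def d_def p_def)
  have d: "d > 0" using dp d0 N by (cases "d = 0") auto
  have p: "p \<noteq> 0" using dp N by auto
  have far: "R / 2 - cmod (z - a) \<ge> d / 2" if "z \<in> ball z0 (d / 2)" for z
    using that norm_triangle_ineq[of "z - z0" "z0 - a"]
    by (simp add: d_def dist_norm norm_minus_commute)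
  have near: "z \<in> cball a (R / 2)" if "z \<in> ball z0 (d / 2)" for z
    using far[OF that] d by (simp add: dist_norm norm_minus_commute)
  \<comment> \<open>On this disk the weight is at least d/2, while \<open>\<phi>\<close> is at most
    d |p|.\<close>
  have bound: "cmod (deriv L z) \<le> 2 * cmod p" if z: "z \<in> ball z0 (d / 2)" for z
  proof -
    have "d / 2 * cmod (deriv L z) \<le> \<phi> z"
      unfolding \<phi>_def using far[OF z] by (intro mult_right_mono) auto
    also have "\<dots> \<le> d * cmod p" using max[OF near[OF z]] by (simp add: \<phi>_def d_def p_def)
    finally show ?thesis using d by simp
  qed
  \<comment> \<open>Scaling by p makes the derivative of L o s equal to 1 at 0, and division by
    \<open>c\<close> makes that of h o s equal to 1 there. As d |p| > 2 N, \<open>s\<close> maps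
    \<open>ball 0 N\<close> into the disk of radius d/2.\<close>
  define s where "s = (\<lambda>\<zeta>. z0 + \<zeta> / p)"
  define c where "c = exp (L z0) / p"
  have c: "c \<noteq> 0" using p by (simp add: c_def)
  have s: "s \<zeta> \<in> ball z0 (d / 2)" if "\<zeta> \<in> ball 0 N" for \<zeta>
  proof -
    have "cmod \<zeta> < d / 2 * cmod p" using that dp by simp
    then show ?thesis using p by (simp add: s_def dist_norm norm_divide pos_divide_less_eq)
  qed
  have sR: "s \<zeta> \<in> ball a R" if "\<zeta> \<in> ball 0 N" for \<zeta> using s[OF that] near half by blast
  have s': "(s has_field_derivative 1 / p) (at \<zeta>)" for \<zeta>
    unfolding s_def using p by (auto intro!: derivative_eq_intros)
  have hols: "s holomorphic_on ball 0 N"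
    unfolding s_def using p by (intro holomorphic_intros) auto
  have comp: "(\<lambda>\<zeta>. f (s \<zeta>)) holomorphic_on ball 0 N" if "f holomorphic_on ball a R" for f
    using sR by (intro holomorphic_on_compose_gen[OF hols that, unfolded o_def] image_subsetI)
  define M where "M = (\<lambda>\<zeta>. L (s \<zeta>) - L z0)"
  \<comment> \<open>Dividing h + cnj g by c divides g by cnj c, so the dilatation picks up this
    unimodular factor.\<close>
  define u where "u = c / cnj c"
  have u: "cmod u = 1" using c by (simp add: u_def norm_divide)
  have M': "deriv M \<zeta> = deriv L (s \<zeta>) / p" if "\<zeta> \<in> ball 0 N" for \<zeta>
  proof -
    have "(M has_field_derivative deriv L (s \<zeta>) * (1 / p) - 0) (at \<zeta>)"
      unfolding M_def
      by (intro DERIV_diff DERIV_const DERIV_chain2[OF holomorphic_derivI[OF holL open_ball sR[OF that]] s'])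
    then show ?thesis by (simp add: DERIV_imp_deriv)
  qed
  have "\<not> inj_on (\<lambda>\<zeta>. h (s \<zeta>) / c + cnj (g (s \<zeta>) / cnj c)) (ball 0 N)"
  proof (rule not_inj_on_near_exp[of N M "\<lambda>\<zeta>. u * \<omega> (s \<zeta>)"])
    show "M holomorphic_on ball 0 N" unfolding M_def by (intro holomorphic_intros comp holL)
    show "(\<lambda>\<zeta>. u * \<omega> (s \<zeta>)) holomorphic_on ball 0 N"
      by (intro holomorphic_intros comp hol\<omega>)
    show "M 0 = 0" by (simp add: M_def s_def)
    show "deriv M 0 = 1" using M'[of 0] N p by (simp add: s_def p_def)
    fix \<zeta> :: complex assume \<zeta>: "\<zeta> \<in> ball 0 N"
    show "cmod (deriv M \<zeta>) \<le> 2"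
      using M'[OF \<zeta>] bound[OF s[OF \<zeta>]] p by (simp add: norm_divide pos_divide_le_eq)
    show "cmod (u * \<omega> (s \<zeta>)) < 1" using \<omega>[OF sR[OF \<zeta>]] u by (simp add: norm_mult)
    have expM: "exp (M \<zeta>) = exp (L (s \<zeta>)) * (1 / p) / c"
      using p by (simp add: M_def exp_diff c_def)
    show "((\<lambda>\<zeta>. h (s \<zeta>) / c) has_field_derivative exp (M \<zeta>)) (at \<zeta>)"
      unfolding expM by (intro DERIV_cdivide DERIV_chain2[OF h[OF sR[OF \<zeta>]] s'])
    have "((\<lambda>\<zeta>. g (s \<zeta>) / cnj c) has_field_derivative
        \<omega> (s \<zeta>) * exp (L (s \<zeta>)) * (1 / p) / cnj c) (at \<zeta>)"
      by (intro DERIV_cdivide DERIV_chain2[OF g[OF sR[OF \<zeta>]] s'])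
    also have "\<omega> (s \<zeta>) * exp (L (s \<zeta>)) * (1 / p) / cnj c = u * \<omega> (s \<zeta>) * exp (M \<zeta>)"
      using c p by (simp add: expM u_def)
    finally show "((\<lambda>\<zeta>. g (s \<zeta>) / cnj c) has_field_derivative u * \<omega> (s \<zeta>) * exp (M \<zeta>)) (at \<zeta>)" .
  qed (simp add: N_def)
  moreover have "inj_on (\<lambda>\<zeta>. h (s \<zeta>) / c + cnj (g (s \<zeta>) / cnj c)) (ball 0 N)"
  proof (rule inj_onI)
    fix x y assume xy: "x \<in> ball 0 N" "y \<in> ball 0 N"
      and "h (s x) / c + cnj (g (s x) / cnj c) = h (s y) / c + cnj (g (s y) / cnj c)"
    then have "h (s x) + cnj (g (s x)) = h (s y) + cnj (g (s y))"
      using c by (simp add: add_divide_distrib[symmetric])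
    then have "s x = s y" using inj_onD[OF inj] sR xy by blast
    then show "x = y" using p by (simp add: s_def)
  qed
  ultimately show False by contradiction
qed

text \<open>\<open>deriv h\<close> has no zeros, so it has a logarithm on the disk. The bound is
  cleared of its denominator so that it can be passed to a limit.\<close>

lemma pre_Schwarzian_bound_of_inj_on:
  assumes R: "R > 0" and holh: "h holomorphic_on ball a R" and holg: "g holomorphic_on ball a R"
    and less: "\<And>z. z \<in> ball a R \<Longrightarrow> cmod (deriv g z) < cmod (deriv h z)"
    and inj: "inj_on (\<lambda>z. h z + cnj (g z)) (ball a R)"
  shows "R * cmod (deriv (deriv h) a) \<le> 400000 * exp 9 * cmod (deriv h a)"
proof -
  note holh' = holomorphic_deriv[OF holh open_ball] and holg' = holomorphic_deriv[OF holg open_ball]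
  have nz: "deriv h z \<noteq> 0" if "z \<in> ball a R" for z using less[OF that] by auto
  obtain L where L: "L holomorphic_on ball a R" "\<And>z. z \<in> ball a R \<Longrightarrow> exp (L z) = deriv h z"
    using holomorphic_logarithm_exists[OF convex_ball open_ball holh' nz, of a] R by auto
  have aR: "a \<in> ball a R" using R by simp
  have "R * cmod (deriv L a) \<le> 400000 * exp 9"
  proof (rule deriv_log_bound_of_inj_on[OF R L(1) _ _ _ _ inj, of "\<lambda>z. deriv g z / deriv h z"])
    show "(\<lambda>z. deriv g z / deriv h z) holomorphic_on ball a R"
      using nz by (intro holomorphic_intros holh' holg')
    fix z assume z: "z \<in> ball a R"
    show "cmod (deriv g z / deriv h z) < 1"
      using less[OF z] nz[OF z] by (simp add: norm_divide)
    show "(h has_field_derivative exp (L z)) (at z)"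
      using holomorphic_derivI[OF holh open_ball z] L(2)[OF z] by simp
    show "(g has_field_derivative deriv g z / deriv h z * exp (L z)) (at z)"
      using holomorphic_derivI[OF holg open_ball z] L(2)[OF z] nz[OF z] by simp
  qed
  moreover have "deriv (deriv h) a = deriv L a * deriv h a"
  proof -
    have "((\<lambda>z. exp (L z)) has_field_derivative exp (L a) * deriv L a) (at a)"
      by (intro DERIV_chain2[OF DERIV_exp] holomorphic_derivI[OF L(1) open_ball aR])
    then have "(deriv h has_field_derivative exp (L a) * deriv L a) (at a)"
      by (rule has_field_derivative_transform_within_open[OF _ open_ball aR]) (simp add: L(2))
    then show ?thesis using L(2)[OF aR] by (simp add: DERIV_imp_deriv mult.commute)
  qed
  ultimately show ?thesis
    using mult_right_mono[of "R * cmod (deriv L a)" "400000 * exp 9" "cmod (deriv h a)"]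
    by (simp add: norm_mult mult.assoc)
qed

section \<open>Affine changes and the bound for H + \<epsilon> G\<close>

text \<open>For |z| < 1 the denominator satisfies |1 - cnj a z| \<ge> 1 - |a|. The radius,
  proportional to 1 - |a|, is the source of the Bloch weight.\<close>

lemma ball_subset_hyperbolic_disk:
  assumes "a \<in> unit_disk"
  shows "ball a (tanh \<rho> * (1 - cmod a)) \<subseteq> hyperbolic_disk a \<rho>"
proof
  fix z assume "z \<in> ball a (tanh \<rho> * (1 - cmod a))"
  then have z: "cmod (z - a) < tanh \<rho> * (1 - cmod a)" by (simp add: dist_norm norm_minus_commute)
  have a: "cmod a < 1" using assms by simp
  have "tanh \<rho> * (1 - cmod a) \<le> 1 * (1 - cmod a)"
    using a by (intro mult_right_mono) (auto simp: less_imp_le tanh_real_lt_1)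
  with z have z1: "cmod z < 1" using norm_triangle_sub[of z a] by simp
  have t: "tanh \<rho> > 0"
    using z a norm_ge_zero[of "z - a"] by (smt (verit) mult_nonpos_nonneg)
  have "cmod a * cmod z \<le> cmod a" using z1 by (simp add: mult_left_le)
  then have le: "1 - cmod a \<le> cmod (1 - cnj a * z)"
    using norm_triangle_ineq2[of 1 "cnj a * z"] by (simp add: norm_mult)
  with a have pos: "cmod (1 - cnj a * z) > 0" by linarith
  have "cmod (z - a) < tanh \<rho> * cmod (1 - cnj a * z)"
    using z mult_left_mono[OF le, of "tanh \<rho>"] t by linarith
  then have "cmod ((z - a) / (1 - cnj a * z)) < tanh \<rho>"
    using pos by (simp add: norm_divide pos_divide_less_eq)
  then show "z \<in> hyperbolic_disk a \<rho>" using z1 by (simp add: hyperbolic_disk_def)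
qed

lemma inj_affine_cnj:
  fixes \<epsilon> :: complex
  assumes "cmod \<epsilon> < 1"
  shows "inj (\<lambda>w. w + \<epsilon> * cnj w)"
proof (rule injI)
  fix x y :: complex assume "x + \<epsilon> * cnj x = y + \<epsilon> * cnj y"
  then have "x - y = - (\<epsilon> * cnj (x - y))" by (simp add: algebra_simps)
  then have "cmod (x - y) = cmod \<epsilon> * cmod (x - y)"
    by (metis complex_mod_cnj norm_minus_cancel norm_mult)
  then show "x = y" using assms by auto
qed

text \<open>Jacobians multiply under composition with w + \<epsilon> cnj w: the difference of the
  squared moduli is (1 - |\<epsilon>|^2)(|A|^2 - |B|^2). It is used with A = H' and B = G'.\<close>

lemma cmod_affine_less:
  fixes A B \<epsilon> :: complex
  assumes "cmod B < cmod A" "cmod \<epsilon> < 1"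
  shows "cmod (B + cnj \<epsilon> * A) < cmod (A + \<epsilon> * B)"
proof -
  have "(cmod (A + \<epsilon> * B))\<^sup>2 - (cmod (B + cnj \<epsilon> * A))\<^sup>2
      = (1 - (cmod \<epsilon>)\<^sup>2) * ((cmod A)\<^sup>2 - (cmod B)\<^sup>2)"
    by (simp add: cmod_power2) algebra
  moreover have "(cmod \<epsilon>)\<^sup>2 < 1" "(cmod B)\<^sup>2 < (cmod A)\<^sup>2"
    using assms by (auto simp: abs_square_less_1 intro: power_strict_mono)
  ultimately have "(cmod (B + cnj \<epsilon> * A))\<^sup>2 < (cmod (A + \<epsilon> * B))\<^sup>2"
    by (smt (verit) mult_pos_pos)
  then show ?thesis by (simp add: power2_less_imp_less)
qed

lemma pre_Schwarzian_bound:
  assumes can: "canonical_decomposition F H G"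
    and jac: "\<And>z. z \<in> unit_disk \<Longrightarrow> harmonic_jacobian H G z > 0"
    and \<rho>: "\<rho> > 0" and a: "a \<in> unit_disk" and inj: "inj_on F (hyperbolic_disk a \<rho>)"
    and \<epsilon>: "cmod \<epsilon> \<le> 1"
  shows "tanh \<rho> * (1 - cmod a) * cmod (deriv (deriv H) a + \<epsilon> * deriv (deriv G) a)
      \<le> 400000 * exp 9 * cmod (deriv H a + \<epsilon> * deriv G a)"
proof -
  define R where "R = tanh \<rho> * (1 - cmod a)"
  have R: "R > 0" using \<rho> a by (simp add: R_def)
  have holH: "H holomorphic_on unit_disk" and holG: "G holomorphic_on unit_disk"
    and F: "\<And>z. z \<in> unit_disk \<Longrightarrow> F z = H z + cnj (G z)"
    using can by (auto simp: canonical_decomposition_def)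
  have sub: "ball a R \<subseteq> hyperbolic_disk a \<rho>"
    unfolding R_def by (rule ball_subset_hyperbolic_disk[OF a])
  then have sub1: "ball a R \<subseteq> unit_disk" by (auto simp: hyperbolic_disk_def)
  have deriv_lin: "deriv (\<lambda>z. f z + t * k z) z = deriv f z + t * deriv k z"
    if "f holomorphic_on unit_disk" "k holomorphic_on unit_disk" "z \<in> unit_disk"
    for f k :: "complex \<Rightarrow> complex" and t z
    using holomorphic_derivI[OF that(1) open_ball that(3)] holomorphic_derivI[OF that(2) open_ball that(3)]
    by (intro DERIV_imp_deriv DERIV_add DERIV_cmult)
  have inner: "R * cmod (deriv (deriv H) a + \<eta> * deriv (deriv G) a)
      \<le> 400000 * exp 9 * cmod (deriv H a + \<eta> * deriv G a)" if \<eta>: "cmod \<eta> < 1" for \<eta>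
  proof -
    \<comment> \<open>These are the analytic and co-analytic parts of F + \<eta> cnj F.\<close>
    define h g where "h = (\<lambda>z. H z + \<eta> * G z)" and "g = (\<lambda>z. G z + cnj \<eta> * H z)"
    have h1: "deriv h z = deriv H z + \<eta> * deriv G z" if "z \<in> unit_disk" for z
      unfolding h_def by (rule deriv_lin[OF holH holG that])
    have "R * cmod (deriv (deriv h) a) \<le> 400000 * exp 9 * cmod (deriv h a)"
    proof (rule pre_Schwarzian_bound_of_inj_on[OF R, of h a g])
      show "h holomorphic_on ball a R" "g holomorphic_on ball a R"
        unfolding h_def g_def
        by (intro holomorphic_intros holomorphic_on_subset[OF holH sub1] holomorphic_on_subset[OF holG sub1])+
      show "cmod (deriv g z) < cmod (deriv h z)" if "z \<in> ball a R" for z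
      proof -
        have z: "z \<in> unit_disk" using that sub1 by blast
        have "cmod (deriv G z) < cmod (deriv H z)"
          using jac[OF z] by (simp add: harmonic_jacobian_def power2_less_imp_less)
        from cmod_affine_less[OF this \<eta>] show ?thesis
          unfolding h1[OF z] by (simp add: g_def deriv_lin[OF holG holH z])
      qed
      have "h z + cnj (g z) = F z + \<eta> * cnj (F z)" if "z \<in> ball a R" for z
        using F[of z] that sub1 by (auto simp: h_def g_def algebra_simps)
      moreover have "inj_on (\<lambda>z. F z + \<eta> * cnj (F z)) (ball a R)"
        using comp_inj_on[OF inj_on_subset[OF inj sub] inj_on_subset[OF inj_affine_cnj[OF \<eta>]]]
        by (simp add: o_def)
      ultimately show "inj_on (\<lambda>z. h z + cnj (g z)) (ball a R)"
        using inj_on_cong[of "ball a R" "\<lambda>z. h z + cnj (g z)" "\<lambda>z. F z + \<eta> * cnj (F z)"] by blast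
    qed
    moreover have "deriv (deriv h) a = deriv (deriv H) a + \<eta> * deriv (deriv G) a"
    proof -
      have "deriv (deriv h) a = deriv (\<lambda>z. deriv H z + \<eta> * deriv G z) a"
        using h1 a by (intro deriv_cong_ev eventually_nhds_in_open[of unit_disk, THEN eventually_mono]) auto
      also have "\<dots> = deriv (deriv H) a + \<eta> * deriv (deriv G) a"
        by (intro deriv_lin holomorphic_deriv holH holG open_ball a)
      finally show ?thesis .
    qed
    ultimately show ?thesis by (simp add: h1[OF a])
  qed
  \<comment> \<open>For |\<epsilon>| = 1 the map w + \<epsilon> cnj w collapses the plane to a line,
    so this case is reached only as a limit; both sides are continuous in \<eta>.\<close>
  have "closed {\<eta>. R * cmod (deriv (deriv H) a + \<eta> * deriv (deriv G) a)
      \<le> 400000 * exp 9 * cmod (deriv H a + \<eta> * deriv G a)}" (is "closed ?S")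
    by (intro closed_Collect_le continuous_intros)
  moreover have "unit_disk \<subseteq> ?S" using inner by auto
  ultimately have "closure unit_disk \<subseteq> ?S" by (rule closure_minimal[rotated])
  then show ?thesis using \<epsilon> by (auto simp: R_def)
qed

section \<open>From the pre-Schwarzian bound to the Bloch-type class\<close>

theorem theorem1:
  fixes F H G :: "complex \<Rightarrow> complex"
  assumes "harmonic_mapping F"
    and "canonical_decomposition F H G"
    and "\<forall>z\<in>unit_disk. harmonic_jacobian H G z > 0"
    and "uniformly_locally_univalent F"
  shows "\<forall>\<epsilon>\<in>cball (0::complex) 1. \<forall>f h g :: complex \<Rightarrow> complex.
           harmonic_mapping f \<longrightarrow> canonical_decomposition f h g \<longrightarrow>
           (\<forall>z\<in>unit_disk. exp (h z) = deriv H z + \<epsilon> * deriv G z) \<longrightarrow>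
           (\<exists>\<omega> :: complex \<Rightarrow> complex. bounded (\<omega> ` unit_disk) \<and>
              (\<forall>z\<in>unit_disk. deriv g z = \<omega> z * deriv h z)) \<longrightarrow>
           f \<in> harmonic_bloch_star"
proof (intro ballI allI impI)
  fix \<epsilon> :: complex and f h g :: "complex \<Rightarrow> complex"
  assume \<epsilon>: "\<epsilon> \<in> cball 0 1" and harm: "harmonic_mapping f"
    and can: "canonical_decomposition f h g"
    and exph: "\<forall>z\<in>unit_disk. exp (h z) = deriv H z + \<epsilon> * deriv G z"
    and "\<exists>\<omega> :: complex \<Rightarrow> complex. bounded (\<omega> ` unit_disk) \<and>
              (\<forall>z\<in>unit_disk. deriv g z = \<omega> z * deriv h z)"
  then obtain \<omega> :: "complex \<Rightarrow> complex" and M where M: "\<And>z. z \<in> unit_disk \<Longrightarrow> cmod (\<omega> z) \<le> M"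
    and \<omega>: "\<And>z. z \<in> unit_disk \<Longrightarrow> deriv g z = \<omega> z * deriv h z"
    unfolding bounded_iff by blast
  obtain \<rho> where \<rho>: "\<rho> > 0" "\<And>a. a \<in> unit_disk \<Longrightarrow> inj_on F (hyperbolic_disk a \<rho>)"
    using assms(4) by (auto simp: uniformly_locally_univalent_def)
  have holH: "H holomorphic_on unit_disk" and holG: "G holomorphic_on unit_disk"
    and holh: "h holomorphic_on unit_disk"
    using assms(2) can by (auto simp: canonical_decomposition_def)
  \<comment> \<open>Differentiating exp h = H' + \<epsilon> G' shows that h' is the pre-Schwarzian
    derivative of H + \<epsilon> G, so \<open>pre_Schwarzian_bound\<close> becomes a Bloch estimate
    for \<open>h\<close> once |exp h| is cancelled.\<close>
  have bloch: "(1 - cmod z) * cmod (deriv h z) \<le> 400000 * exp 9 / tanh \<rho>" if z: "z \<in> unit_disk" for z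
  proof -
    have "((\<lambda>z. exp (h z)) has_field_derivative exp (h z) * deriv h z) (at z)"
      by (intro DERIV_chain2[OF DERIV_exp] holomorphic_derivI[OF holh open_ball z])
    then have "((\<lambda>z. deriv H z + \<epsilon> * deriv G z) has_field_derivative exp (h z) * deriv h z) (at z)"
      by (rule has_field_derivative_transform_within_open[OF _ open_ball z]) (use exph in auto)
    moreover have "((\<lambda>z. deriv H z + \<epsilon> * deriv G z) has_field_derivative
        deriv (deriv H) z + \<epsilon> * deriv (deriv G) z) (at z)"
      by (intro DERIV_add DERIV_cmult holomorphic_derivI[OF _ open_ball z] holomorphic_deriv holH holG open_ball)
    ultimately have eq: "deriv (deriv H) z + \<epsilon> * deriv (deriv G) z = exp (h z) * deriv h z"
      by (rule DERIV_unique[symmetric])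
    have "(tanh \<rho> * (1 - cmod z) * cmod (deriv h z)) * cmod (exp (h z))
        \<le> 400000 * exp 9 * cmod (exp (h z))"
      using pre_Schwarzian_bound[OF assms(2) _ \<rho>(1) z \<rho>(2)[OF z], of \<epsilon>] assms(3) \<epsilon> exph z
      unfolding eq by (simp only: norm_mult) (simp add: mult_ac)
    then have "tanh \<rho> * (1 - cmod z) * cmod (deriv h z) \<le> 400000 * exp 9"
      by (rule mult_right_le_imp_le) simp
    then show ?thesis using \<rho>(1) by (simp add: field_simps)
  qed
  \<comment> \<open>The factor 2 comes from 1 - x^2 \<le> 2 (1 - x), and 1 + M from |J| \<le> |h'|^2
    + |g'|^2 \<le> (1 + M)^2 |h'|^2.\<close>
  have "(1 - (cmod z)\<^sup>2) * sqrt \<bar>harmonic_jacobian h g z\<bar> \<le> 2 * (400000 * exp 9 / tanh \<rho>) * (1 + M)"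
    if z: "z \<in> unit_disk" for z
  proof -
    have z1: "cmod z < 1" using z by simp
    have M0: "0 \<le> M" using M[OF z] norm_ge_zero order_trans by blast
    have "\<bar>harmonic_jacobian h g z\<bar> \<le> (cmod (deriv h z))\<^sup>2 + (cmod (deriv g z))\<^sup>2"
      by (simp add: harmonic_jacobian_def abs_le_iff)
    also have "cmod (deriv g z) \<le> M * cmod (deriv h z)"
      using \<omega>[OF z] M[OF z] by (simp add: norm_mult mult_right_mono)
    then have "(cmod (deriv g z))\<^sup>2 \<le> (M * cmod (deriv h z))\<^sup>2"
      by (intro power_mono) auto
    also have "(cmod (deriv h z))\<^sup>2 + (M * cmod (deriv h z))\<^sup>2 \<le> ((1 + M) * cmod (deriv h z))\<^sup>2"
      using M0 by (simp add: power2_eq_square algebra_simps)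
    finally have "sqrt \<bar>harmonic_jacobian h g z\<bar> \<le> (1 + M) * cmod (deriv h z)"
      using M0 by (intro real_le_lsqrt) auto
    moreover have "1 - (cmod z)\<^sup>2 \<le> 2 * (1 - cmod z)"
      using zero_le_power2[of "1 - cmod z"] by (simp add: power2_eq_square algebra_simps)
    ultimately have "(1 - (cmod z)\<^sup>2) * sqrt \<bar>harmonic_jacobian h g z\<bar>
        \<le> (2 * (1 - cmod z)) * ((1 + M) * cmod (deriv h z))"
      using z1 by (intro mult_mono) auto
    also have "\<dots> = 2 * ((1 - cmod z) * cmod (deriv h z)) * (1 + M)" by simp
    also have "\<dots> \<le> 2 * (400000 * exp 9 / tanh \<rho>) * (1 + M)"
      using bloch[OF z] M0 by (intro mult_right_mono mult_left_mono) auto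
    finally show ?thesis .
  qed
  then have "bdd_above ((\<lambda>z. (1 - (cmod z)\<^sup>2) * sqrt \<bar>harmonic_jacobian h g z\<bar>) ` unit_disk)"
    by (rule bdd_aboveI2)
  with harm can show "f \<in> harmonic_bloch_star"
    by (auto simp: harmonic_bloch_star_def)
qed

end
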